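(* For $c>0$ and an integer $n$, let $$A_H(c,n):=\frac{\Big\{\frac{n}{2}\gamma\big(\frac{n}{2},\frac{c^2}{2}\big)+2^{-\frac32}c(n-1)\Gamma\big(\frac{n-1}{2},\frac{c^2}{2}\big)\Big\}^2}{\Gamma\big(\frac{n+2}{2}\big)\Big\{\gamma\big(\frac{n+2}{2},\frac{c^2}{2}\big)+\frac{c^2}{2}\Gamma\big(\frac n2,\frac{c^2}{2}\big)\Big\}}.$$ (a) For every integer $n\ge 2$, $$\lim_{c\to0^+}A_H(c,n)=A_{L_1}(n),\qquad\text{where } A_{L_1}(n):=\frac{\Gamma^2\big(\frac{n+1}{2}\big)}{\Gamma\big(\frac n2\big)\Gamma\big(\frac{n+2}{2}\big)}.$$ (b) $A_{L_1}(n)$, given by the right-hand formula above, is increasing in $n\in\mathbb{Z}^+$, i.e. $A_{L_1}(n)<A_{L_1}(n+1)$ for all integers $n\ge1$. (c) $\lim_{n\to\infty}A_{L_1}(n)=1$.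
   Context: $\Gamma(z)$ is the gamma function, $\gamma(a,z)=\int_0^z t^{a-1}e^{-t}\,dt$ is the lower incomplete gamma function and $\Gamma(a,z)=\int_z^\infty t^{a-1}e^{-t}\,dt$ is the upper incomplete gamma function. ($A_H(c,n)$ and $A_{L_1}(n)$ are the approximate asymptotic relative efficiencies of the Huber estimator with cutoff $c$, respectively the $L_1$ estimator, with respect to the $L_2$ estimator under an isotropic normal distribution in dimension $n$.) *)

theory Defs
  imports "HOL-Analysis.Analysis"
begin

(* The integrands are nonnegative, so the Henstock-Kurzweil integral agrees with the Lebesgue
   integral. At t = 0 the value 0 powr (a - 1) = 0 affects only a null set. *)

definition lower_Gamma :: "real \<Rightarrow> real \<Rightarrow> real" where
  "lower_Gamma a z = integral {0..z} (\<lambda>t. t powr (a - 1) * exp (- t))"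

definition upper_Gamma :: "real \<Rightarrow> real \<Rightarrow> real" where
  "upper_Gamma a z = integral {z..} (\<lambda>t. t powr (a - 1) * exp (- t))"

(* Approximate asymptotic relative efficiencies, with respect to the L2 estimator under an
   isotropic normal distribution in dimension n, of the Huber estimator with cutoff c and
   of the L1 estimator. *)

definition A_H :: "real \<Rightarrow> nat \<Rightarrow> real" where
  "A_H c n =
     (real n / 2 * lower_Gamma (real n / 2) (c\<^sup>2 / 2)
       + 2 powr (- (3 / 2)) * c * (real n - 1) * upper_Gamma ((real n - 1) / 2) (c\<^sup>2 / 2))\<^sup>2
     / (Gamma ((real n + 2) / 2)
        * (lower_Gamma ((real n + 2) / 2) (c\<^sup>2 / 2)
           + c\<^sup>2 / 2 * upper_Gamma (real n / 2) (c\<^sup>2 / 2)))"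

definition A_L1 :: "nat \<Rightarrow> real" where
  "A_L1 n = (Gamma ((real n + 1) / 2))\<^sup>2 / (Gamma (real n / 2) * Gamma ((real n + 2) / 2))"

end

theory Submission
  imports Defs
begin

text \<open>
  For (a), divide the numerator and the denominator of \<open>A_H c n\<close> by \<open>c\<^sup>2\<close>: since
  \<open>lower_Gamma a z \<le> z powr a / a\<close>, the terms with the lower incomplete Gamma function vanish
  in the limit, and \<open>upper_Gamma a (c\<^sup>2 / 2)\<close> tends to \<open>Gamma a\<close>.

  For (b) and (c), the functional equation gives \<open>A_L1 n * A_L1 (n + 1) = n / (n + 1)\<close>. Together
  with \<open>A_L1 n \<le> 1\<close>, which is the log-convexity of Gamma, this squeezes \<open>A_L1 n\<close> between
  \<open>n / (n + 1)\<close> and 1. By the product formula, \<open>A_L1 n < A_L1 (n + 1)\<close> amounts to \<open>B n < 1\<close> for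
  \<open>B n = (A_L1 n)\<^sup>2 * (n + 1) / n\<close>. The ratio \<open>B (n + 2) / B n\<close> is an explicit rational function
  of \<open>n\<close> that exceeds 1, so \<open>B\<close> increases strictly to its limit 1 along steps of two.
\<close>

lemma lower_Gamma_integrable:
  assumes "a > 0" "z \<ge> 0"
  shows "(\<lambda>t::real. t powr (a - 1) * exp (- t)) integrable_on {0..z}"
  using Gamma_integral_real[OF assms(1)] assms
  by (auto simp: has_integral_integrable exp_minus divide_inverse
      intro!: integrable_on_subinterval[where S = "{0..}"])

lemma upper_Gamma_eq:
  assumes "a > 0" "z \<ge> 0"
  shows "upper_Gamma a z = Gamma a - lower_Gamma a z"
proof -
  let ?f = "\<lambda>t::real. t powr (a - 1) * exp (- t)"
  have total: "(?f has_integral Gamma a) {0..}"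
    using Gamma_integral_real[OF assms(1)] by (simp add: exp_minus divide_inverse)
  have "(?f has_integral lower_Gamma a z) {0..z}"
    unfolding lower_Gamma_def using lower_Gamma_integrable[OF assms] by (rule integrable_integral)
  then have "((\<lambda>t. if t \<in> {0..z} then ?f t else 0) has_integral lower_Gamma a z) {0..}"
    by (subst has_integral_restrict) auto
  with total have "((\<lambda>t. ?f t - (if t \<in> {0..z} then ?f t else 0)) has_integral
      (Gamma a - lower_Gamma a z)) {0..}"
    by (rule has_integral_diff)
  \<comment> \<open>The two integrands agree on \<open>{0..}\<close> except possibly at
    \<open>z\<close>, which lies in both pieces of the split Euler integral; a single point is
    negligible.\<close>
  then have "((\<lambda>t. if t \<in> {z..} then ?f t else 0) has_integral
      (Gamma a - lower_Gamma a z)) {0..}"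
    by (rule has_integral_spike_finite[of "{z}", rotated 2]) auto
  then have "(?f has_integral (Gamma a - lower_Gamma a z)) {z..}"
    using assms by (subst (asm) has_integral_restrict) auto
  then show ?thesis
    unfolding upper_Gamma_def by (rule integral_unique)
qed

lemma lower_Gamma_nonneg:
  assumes "a > 0" "z \<ge> 0"
  shows "lower_Gamma a z \<ge> 0"
  unfolding lower_Gamma_def using lower_Gamma_integrable[OF assms]
  by (rule integral_nonneg) simp

text \<open>Bounding \<open>exp (- t)\<close> by 1 leaves the integral of a power.\<close>

lemma lower_Gamma_le:
  assumes "a > 0" "z \<ge> 0"
  shows "lower_Gamma a z \<le> z powr a / a"
proof -
  have "((\<lambda>t. t powr (a - 1)) has_integral (z powr a / a)) {0..z}"
    using has_integral_powr_from_0[of "a - 1" z] assms by simp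
  then show ?thesis
    unfolding lower_Gamma_def
    by (rule has_integral_le[OF integrable_integral[OF lower_Gamma_integrable[OF assms]]])
      (auto intro!: mult_left_le)
qed

text \<open>At \<open>z = c\<^sup>2 / 2\<close> the bound \<open>z powr a / a\<close> is a constant
  times \<open>c powr (2 * a)\<close>, which beats \<open>c ^ k\<close>. The case
  \<open>k = 0\<close> gives the limit of \<open>upper_Gamma\<close>; \<open>k = 1\<close> and
  \<open>k = 2\<close> serve the numerator and denominator of \<open>A_H\<close>.\<close>

lemma lower_Gamma_smallo:
  fixes a :: real
  assumes "a > 0" "real k < 2 * a"
  shows "((\<lambda>c. lower_Gamma a (c\<^sup>2 / 2) / c ^ k) \<longlongrightarrow> 0) (at_right 0)"
proof (rule tendsto_sandwich)
  show "\<forall>\<^sub>F c in at_right 0. 0 \<le> lower_Gamma a (c\<^sup>2 / 2) / c ^ k"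
    using eventually_at_right_less[of 0]
    by eventually_elim (use assms lower_Gamma_nonneg in auto)
  show "\<forall>\<^sub>F c in at_right 0. lower_Gamma a (c\<^sup>2 / 2) / c ^ k \<le> c powr (2 * a - k) / (2 powr a * a)"
    using eventually_at_right_less[of 0]
  proof eventually_elim
    case (elim c)
    have "lower_Gamma a (c\<^sup>2 / 2) / c ^ k \<le> ((c\<^sup>2 / 2) powr a / a) / c ^ k"
      using elim assms by (intro divide_right_mono lower_Gamma_le) auto
    also have "(c\<^sup>2 / 2) powr a = c powr (2 * a) / 2 powr a"
      using elim by (simp add: powr_divide powr_powr flip: powr_numeral)
    also have "c powr (2 * a) / 2 powr a / a / c ^ k = c powr (2 * a - k) / (2 powr a * a)"
      using elim by (simp add: powr_diff powr_realpow)
    finally show ?case .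
  qed
  have "((\<lambda>c::real. c powr (2 * a - k)) \<longlongrightarrow> 0) (at_right 0)"
    using assms by (intro tendsto_zero_powrI[of _ _ "\<lambda>_. 2 * a - k" "2 * a - k"] tendsto_ident_at)
      (auto simp: eventually_at_filter)
  then show "((\<lambda>c::real. c powr (2 * a - k) / (2 powr a * a)) \<longlongrightarrow> 0) (at_right 0)"
    by (rule tendsto_divide_zero)
qed simp

lemma upper_Gamma_tendsto:
  assumes "a > 0"
  shows "((\<lambda>c. upper_Gamma a (c\<^sup>2 / 2)) \<longlongrightarrow> Gamma a) (at_right 0)"
proof -
  have "((\<lambda>c. Gamma a - lower_Gamma a (c\<^sup>2 / 2)) \<longlongrightarrow> Gamma a - 0) (at_right 0)"
    using lower_Gamma_smallo[of a 0] assms by (intro tendsto_diff tendsto_const) auto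
  then show ?thesis
    using assms by (simp add: upper_Gamma_eq)
qed

text \<open>The bound \<open>n \<ge> 2\<close> makes
  \<open>lower_Gamma (n / 2) (c\<^sup>2 / 2)\<close> of smaller order than \<open>c\<close>, which
  takes \<open>1 < n\<close>, and keeps the argument \<open>(n - 1) / 2\<close> of Gamma
  positive.\<close>

lemma A_H_tendsto_A_L1:
  assumes "n \<ge> 2"
  shows "((\<lambda>c. A_H c n) \<longlongrightarrow> A_L1 n) (at_right 0)"
proof -
  \<comment> \<open>\<open>?N\<close> is the base of the squared numerator divided by
    \<open>c\<close>, and \<open>?D\<close> is the denominator divided by
    \<open>c\<^sup>2\<close>.\<close>
  let ?N = "\<lambda>c. real n / 2 * (lower_Gamma (real n / 2) (c\<^sup>2 / 2) / c ^ 1)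
       + 2 powr (- (3 / 2)) * (real n - 1) * upper_Gamma ((real n - 1) / 2) (c\<^sup>2 / 2)"
  let ?D = "\<lambda>c. Gamma ((real n + 2) / 2)
        * (lower_Gamma ((real n + 2) / 2) (c\<^sup>2 / 2) / c ^ 2
           + 1 / 2 * upper_Gamma (real n / 2) (c\<^sup>2 / 2))"
  have n: "real n \<ge> 2"
    using assms by simp
  have nz: "Gamma (real n / 2) \<noteq> 0" "Gamma ((real n + 2) / 2) \<noteq> 0"
    using n by (auto intro!: Gamma_real_pos less_imp_neq[symmetric])
  have "((\<lambda>c. (?N c)\<^sup>2 / ?D c) \<longlongrightarrow>
      (real n / 2 * 0 + 2 powr (- (3 / 2)) * (real n - 1) * Gamma ((real n - 1) / 2))\<^sup>2
      / (Gamma ((real n + 2) / 2) * (0 + 1 / 2 * Gamma (real n / 2)))) (at_right 0)"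
    using n by (intro tendsto_intros lower_Gamma_smallo upper_Gamma_tendsto)
      (use nz in auto)
  also have "(real n / 2 * 0 + 2 powr (- (3 / 2)) * (real n - 1) * Gamma ((real n - 1) / 2))\<^sup>2
      / (Gamma ((real n + 2) / 2) * (0 + 1 / 2 * Gamma (real n / 2))) = A_L1 n"
  proof -
    have "Gamma ((real n + 1) / 2) = Gamma ((real n - 1) / 2 + 1)"
      by (simp add: field_simps)
    also have "\<dots> = (real n - 1) / 2 * Gamma ((real n - 1) / 2)"
      using n by (intro Gamma_plus1) (auto elim!: nonpos_Ints_cases)
    finally have "(real n - 1) * Gamma ((real n - 1) / 2) = 2 * Gamma ((real n + 1) / 2)"
      by simp
    \<comment> \<open>The constant 1/8 times the square of the 2 just obtained gives 1/2, which
      cancels the 1/2 in the denominator.\<close>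
    moreover have "(2 powr (- (3 / 2)))\<^sup>2 = (1 / 8 :: real)"
      by (simp only: powr_power) (simp add: powr_minus_divide)
    ultimately have
      "(real n / 2 * 0 + 2 powr (- (3 / 2)) * (real n - 1) * Gamma ((real n - 1) / 2))\<^sup>2
        = (Gamma ((real n + 1) / 2))\<^sup>2 / 2"
      by (simp add: mult.assoc power_mult_distrib)
    then show ?thesis
      by (simp only: A_L1_def) (simp add: mult.commute)
  qed
  finally show ?thesis
  proof (rule Lim_transform_eventually)
    show "\<forall>\<^sub>F c in at_right 0. (?N c)\<^sup>2 / ?D c = A_H c n"
      using eventually_at_right_less[of 0]
    proof eventually_elim
      case (elim c)
      have "A_H c n = (c * ?N c)\<^sup>2 / (c\<^sup>2 * ?D c)"
        unfolding A_H_def using elim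
        by (intro arg_cong2[of _ _ _ _ "(/)"] arg_cong[of _ _ "\<lambda>x. x\<^sup>2"])
          (simp_all add: algebra_simps)
      then show ?case
        using elim by (simp add: power_mult_distrib)
    qed
  qed
qed

lemma A_L1_pos:
  assumes "n \<ge> 1"
  shows "A_L1 n > 0"
  using assms unfolding A_L1_def
  by (intro divide_pos_pos mult_pos_pos zero_less_power Gamma_real_pos) auto

text \<open>The argument \<open>(n + 1) / 2\<close> is the midpoint of \<open>n / 2\<close> and
  \<open>(n + 2) / 2\<close>, so log-convexity is applied with weight 1/2.\<close>

lemma A_L1_le_1:
  assumes "n \<ge> 1"
  shows "A_L1 n \<le> 1"
proof -
  define x y where "x = real n / 2" and "y = (real n + 2) / 2"
  have xy: "x > 0" "y > 0" "(real n + 1) / 2 = (1 - 1/2) * x + 1/2 * y"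
    using assms by (auto simp: x_def y_def field_simps)
  define g where "g = Gamma ((real n + 1) / 2)"
  have pos: "Gamma x > 0" "Gamma y > 0" "g > 0"
    using xy(1,2) by (auto simp: g_def intro!: Gamma_real_pos)
  have "ln g \<le> (1 - 1/2) * ln (Gamma x) + 1/2 * ln (Gamma y)"
    using convex_onD[OF log_convex_Gamma_real, of "1/2" x y] xy(1,2)
    unfolding g_def xy(3) by simp
  then have "ln (g\<^sup>2) \<le> ln (Gamma x * Gamma y)"
    using pos by (simp add: ln_mult ln_realpow)
  then have "g\<^sup>2 \<le> Gamma x * Gamma y"
    using pos by (subst (asm) ln_le_cancel_iff) auto
  then show ?thesis
    using pos by (simp add: A_L1_def g_def x_def y_def)
qed

lemma A_L1_mult_Suc:
  assumes "n \<ge> 1"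
  shows "A_L1 n * A_L1 (n + 1) = real n / (real n + 1)"
proof -
  define a where "a = real n / 2"
  have a: "a > 0" "real n = 2 * a" using assms by (auto simp: a_def)
  have pos: "Gamma a > 0" "Gamma (a + 1/2) > 0"
    using a by (auto intro!: Gamma_real_pos)
  have rec: "Gamma (a + 1) = a * Gamma a" "Gamma (a + 1/2 + 1) = (a + 1/2) * Gamma (a + 1/2)"
    using a by (intro Gamma_plus1; auto elim!: nonpos_Ints_cases)+
  have "A_L1 n = (Gamma (a + 1/2))\<^sup>2 / (Gamma a * Gamma (a + 1))"
    "A_L1 (n + 1) = (Gamma (a + 1))\<^sup>2 / (Gamma (a + 1/2) * Gamma (a + 1/2 + 1))"
    by (simp_all add: A_L1_def a add_divide_distrib add_ac)
  \<comment> \<open>Here \<open>p\<close> and \<open>q\<close> stand for \<open>Gamma a\<close> and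
    \<open>Gamma (a + 1/2)\<close>; all Gamma values cancel.\<close>
  moreover have "q\<^sup>2 / (p * (a * p)) * ((a * p)\<^sup>2 / (q * ((a + 1/2) * q))) = a / (a + 1/2)"
    if "p > 0" "q > 0" for p q :: real
    using a(1) that by (simp add: divide_simps power2_eq_square)
  ultimately have "A_L1 n * A_L1 (n + 1) = a / (a + 1/2)"
    using pos by (simp only: rec)
  also have "\<dots> = real n / (real n + 1)"
    using a by (simp add: divide_simps)
  finally show ?thesis .
qed

lemma A_L1_tendsto: "A_L1 \<longlonglongrightarrow> 1"
proof (rule tendsto_sandwich)
  show "\<forall>\<^sub>F n in sequentially. real n / (real n + 1) \<le> A_L1 n"
    using eventually_ge_at_top[of 1]
  proof eventually_elim
    case (elim n)
    then have "A_L1 n * A_L1 (n + 1) \<le> A_L1 n * 1"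
      using A_L1_le_1[of "n + 1"] A_L1_pos[of n] by (intro mult_left_mono) auto
    then show ?case
      using A_L1_mult_Suc[OF elim] by simp
  qed
  show "\<forall>\<^sub>F n in sequentially. A_L1 n \<le> 1"
    using eventually_ge_at_top[of 1] by eventually_elim (rule A_L1_le_1)
  show "(\<lambda>n. real n / (real n + 1)) \<longlonglongrightarrow> 1"
    using LIMSEQ_n_over_Suc_n by (simp add: add.commute)
qed simp

lemma A_L1_square_less:
  assumes "n \<ge> 1"
  shows "(A_L1 n)\<^sup>2 < real n / (real n + 1)"
proof -
  define B where "B k = (A_L1 k)\<^sup>2 * ((real k + 1) / real k)" for k
  have step: "B k < B (k + 2)" if "k \<ge> 1" for k
  proof -
    define x where "x = real k"
    have x: "x > 0" using that by (simp add: x_def)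
    have "A_L1 k * A_L1 (k + 1) = x / (x + 1)"
      "A_L1 (k + 1) * A_L1 (k + 2) = (x + 1) / (x + 2)"
      using A_L1_mult_Suc[of k] A_L1_mult_Suc[of "k + 1"] that by (auto simp: x_def add_ac)
    moreover have nz: "A_L1 (k + 1) \<noteq> 0"
      using A_L1_pos[of "k + 1"] by simp
    ultimately have eqs: "A_L1 k = x / (x + 1) / A_L1 (k + 1)"
      "A_L1 (k + 2) = (x + 1) / (x + 2) / A_L1 (k + 1)"
      by (metis nonzero_mult_div_cancel_right, metis nonzero_mult_div_cancel_left)
    \<comment> \<open>Eliminating \<open>A_L1 (k + 1)\<close> from two consecutive product formulas
      gives a two-step recurrence with a rational factor.\<close>
    have rec: "A_L1 (k + 2) = A_L1 k * ((x + 1)\<^sup>2 / (x * (x + 2)))"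
      using nz x unfolding eqs by (simp add: divide_simps power2_eq_square)
    \<comment> \<open>The right side exceeds the left by \<open>2 * x + 3\<close>.\<close>
    have "x * (x + 2) ^ 3 < (x + 1) ^ 3 * (x + 3)"
      using x by (simp add: power3_eq_cube algebra_simps)
    then have "1 < (x + 1) ^ 3 * (x + 3) / (x * (x + 2) ^ 3)"
      using x by simp
    then have "B k * 1 < B k * ((x + 1) ^ 3 * (x + 3) / (x * (x + 2) ^ 3))"
      using A_L1_pos[OF that] x by (intro mult_strict_left_mono) (auto simp: B_def x_def)
    also have "\<dots> = B (k + 2)"
    proof -
      have "A\<^sup>2 * ((x + 1) / x) * ((x + 1) ^ 3 * (x + 3) / (x * (x + 2) ^ 3)) =
          (A * ((x + 1)\<^sup>2 / (x * (x + 2))))\<^sup>2 * ((x + 2 + 1) / (x + 2))" for A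
        using x by (simp add: divide_simps) (simp add: eval_nat_numeral algebra_simps)
      then show ?thesis
        by (simp only: B_def rec x_def of_nat_add of_nat_numeral)
    qed
    finally show ?thesis by simp
  qed
  have "(\<lambda>k. (real k + 1) / real k) \<longlonglongrightarrow> 1"
    using LIMSEQ_Suc_n_over_n by (simp add: add.commute)
  then have "B \<longlonglongrightarrow> 1\<^sup>2 * 1"
    unfolding B_def by (intro tendsto_intros A_L1_tendsto)
  \<comment> \<open>The subsequence starts at \<open>n + 2\<close> because the limit yields only a
    weak bound there; the remaining step from \<open>n\<close> to \<open>n + 2\<close> makes it
    strict.\<close>
  then have lim: "(\<lambda>j. B (n + 2 + 2 * j)) \<longlonglongrightarrow> 1"
    using LIMSEQ_subseq_LIMSEQ[of B 1 "\<lambda>j. n + 2 + 2 * j"] by (simp add: strict_mono_def o_def)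
  have "incseq (\<lambda>j. B (n + 2 + 2 * j))"
  proof (rule incseq_SucI)
    fix j show "B (n + 2 + 2 * j) \<le> B (n + 2 + 2 * Suc j)"
      using step[of "n + 2 + 2 * j"] by (simp add: add_ac)
  qed
  then have "B (n + 2 + 2 * 0) \<le> 1"
    using lim by (rule incseq_le)
  then have "B n < 1"
    using step[OF assms] by simp
  then show ?thesis
    using assms by (simp add: B_def field_simps)
qed

lemma A_L1_less_Suc:
  assumes "n \<ge> 1"
  shows "A_L1 n < A_L1 (n + 1)"
proof -
  \<comment> \<open>Both sides are compared through \<open>n / (n + 1)\<close>; the positive factor
    \<open>A_L1 n\<close> then cancels.\<close>
  have "A_L1 n * A_L1 n < A_L1 n * A_L1 (n + 1)"
    using A_L1_square_less[OF assms] A_L1_mult_Suc[OF assms] by (simp add: power2_eq_square)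
  then show ?thesis
    using A_L1_pos[OF assms] by simp
qed

theorem proposition3:
  shows "(\<forall>n::nat. n \<ge> 2 \<longrightarrow> ((\<lambda>c. A_H c n) \<longlongrightarrow> A_L1 n) (at_right 0))
    \<and> (\<forall>n::nat. n \<ge> 1 \<longrightarrow> A_L1 n < A_L1 (n + 1))
    \<and> A_L1 \<longlonglongrightarrow> 1"
  using A_H_tendsto_A_L1 A_L1_less_Suc A_L1_tendsto by blast

end
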